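(* Let $d,k\ge1$ and $\ell\ge0$ be integers and let $\boldsymbol\nu=(\nu_0,\dots,\nu_{k-1})\in\mathbb Z_{>0}^k$. Let $C_d=\langle\sigma_d\rangle$ be the cyclic group of order $d$. The rule $\mathbf w\mapsto\sigma_d\bullet\mathbf w$ (rotation of the first non-constant length-$d$ block, defined in the context) defines an action of $C_d$ on the set of words $\mathcal W_\ell(d;\boldsymbol\nu)$; in particular $\mathcal W_\ell(d;\boldsymbol\nu)$ is closed under $\mathbf w\mapsto \sigma_d\bullet\mathbf w$.
   Context: Let $\mathbf M_\ell(d;\boldsymbol\nu)=\{(m_0,\dots,m_{kd-1})\in\mathbb Z_{\ge0}^{kd}:\sum_{j=0}^{k-1}\nu_j(m_{jd}+m_{jd+1}+\cdots+m_{jd+d-1})=\ell\}$. To $\mathbf m\in\mathbf M_\ell(d;\boldsymbol\nu)$ associate the word $\mathbf w(\mathbf m;d;\boldsymbol\nu)$ with letters in $\{0,\nu_0,\dots,\nu_{k-1}\}$ obtained by writing, for $i=0,1,\dots,kd-1$ in this order, $m_i$ copies of the letter $\nu_{\lfloor i/d\rfloor}$, and inserting one letter $0$ between the $i$-th and $(i+1)$-st of these groups for each $0\le i\le kd-2$ (so the word contains exactly $kd-1$ zeros). Set $\mathcal W_\ell(d;\boldsymbol\nu)=\{\mathbf w(\mathbf m;d;\boldsymbol\nu):\mathbf m\in\mathbf M_\ell(d;\boldsymbol\nu)\}$ (words may have different lengths). For a word $\mathbf w=w_1w_2\cdots w_u$ let $t=\lfloor u/d\rfloor$ and $w^j=w_{(j-1)d+1}\cdots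 w_{jd}$ for $1\le j\le t$. The cyclic shift of a block is $\sigma_d\cdot w^j=w_{jd}w_{(j-1)d+1}\cdots w_{jd-1}$. If $j_0$ is the smallest index with $\sigma_d\cdot w^{j_0}\ne w^{j_0}$, then $\sigma_d\bullet\mathbf w$ is the word obtained from $\mathbf w$ by replacing the block $w^{j_0}$ by $\sigma_d\cdot w^{j_0}$ and leaving everything else (including the trailing letters $w_{td+1}\cdots w_u$) unchanged; if no such $j_0$ exists, $\sigma_d\bullet\mathbf w=\mathbf w$. *)

theory Defs
  imports "HOL-Algebra.Group_Action" "HOL-Algebra.Generated_Groups"
begin

(* The tuple nu = (nu_0, ..., nu_{k-1}) is a list, so k = length nu, and nu_j is nu ! j. *)

definition mult_tuples :: "nat \<Rightarrow> nat list \<Rightarrow> nat \<Rightarrow> nat list set" where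
  "mult_tuples d \<nu> l =
     {m. length m = length \<nu> * d \<and>
         (\<Sum>j<length \<nu>. \<nu> ! j * (\<Sum>i<d. m ! (j * d + i))) = l}"

(* The zero between the groups i and i + 1 is written in front of group i + 1. *)
definition word_of :: "nat \<Rightarrow> nat list \<Rightarrow> nat list \<Rightarrow> nat list" where
  "word_of d \<nu> m =
     concat (map (\<lambda>i. (if i = 0 then [] else [0]) @ replicate (m ! i) (\<nu> ! (i div d)))
                 [0..<length \<nu> * d])"

definition words :: "nat \<Rightarrow> nat list \<Rightarrow> nat \<Rightarrow> nat list set" where
  "words d \<nu> l = word_of d \<nu> ` mult_tuples d \<nu> l"

(* Blocks are numbered from 1; block d w j is a full block for 1 <= j <= length w div d. *)
definition block :: "nat \<Rightarrow> 'a list \<Rightarrow> nat \<Rightarrow> 'a list" where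
  "block d w j = take d (drop ((j - 1) * d) w)"

(* The last letter moves to the front: the inverse of the library's rotate1. *)
definition cyc_shift :: "'a list \<Rightarrow> 'a list" where
  "cyc_shift b = (if b = [] then [] else last b # butlast b)"

definition moved_block :: "nat \<Rightarrow> 'a list \<Rightarrow> nat \<Rightarrow> bool" where
  "moved_block d w j \<longleftrightarrow>
     1 \<le> j \<and> j \<le> length w div d \<and> cyc_shift (block d w j) \<noteq> block d w j"

definition sigma_bullet :: "nat \<Rightarrow> 'a list \<Rightarrow> 'a list" where
  "sigma_bullet d w =
     (if \<exists>j. moved_block d w j
      then let j0 = (LEAST j. moved_block d w j)
           in take ((j0 - 1) * d) w @ cyc_shift (block d w j0) @ drop (j0 * d) w
      else w)"

end

theory Submission
  imports Defs "HOL-Algebra.Multiplicative_Group"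
begin

text \<open>
  Membership of a word \<open>w\<close> in \<open>words d \<nu> l\<close> means that \<open>w\<close> has \<open>k d - 1\<close> zeros, that its letters
  sum to \<open>l\<close>, and that a nonzero letter preceded by \<open>z\<close> zeros equals \<open>\<nu> ! (z div d)\<close>. The blocks
  before the first non-constant one are constant, so the number of zeros in front of it is a
  multiple \<open>q d\<close> of \<open>d\<close>. It contains fewer than \<open>d\<close> zeros itself, so all its nonzero letters are
  \<open>\<nu> ! q\<close>, in whatever order its letters are put. Its rotations are non-constant too, so
  iterating the rule keeps rotating the same block, and the \<open>d\<close>-th iterate is the identity.
\<close>

section \<open>Actions of a finite cyclic group\<close>

text \<open>Equal powers of \<open>\<sigma>\<close> have exponents congruent mod \<open>d\<close>,
  and on \<open>S\<close> the iterates of \<open>f\<close> depend only on the exponent mod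
  \<open>d\<close>; hence sending \<open>\<sigma> [^] n\<close> to \<open>f ^^ n\<close> is well
  defined.\<close>

lemma (in group) cyclic_group_action:
  assumes \<sigma>: "\<sigma> \<in> carrier G" "carrier G = generate G {\<sigma>}" and d: "order G = d" "d > 0"
    and closed: "\<And>x. x \<in> S \<Longrightarrow> f x \<in> S" and period: "\<And>x. x \<in> S \<Longrightarrow> (f ^^ d) x = x"
  shows "\<exists>\<phi>. group_action G S \<phi> \<and> (\<forall>x\<in>S. \<phi> \<sigma> x = f x)"
proof -
  have ord: "ord \<sigma> = d"
    using generate_pow_card[OF \<sigma>(1)] \<sigma>(2) d by (simp add: order_def)
  have closed_pow: "(f ^^ n) x \<in> S" if "x \<in> S" for n x
    using that closed by (induction n) auto
  have period_mult: "(f ^^ (q * d)) x = x" if "x \<in> S" for q x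
    by (induction q) (simp_all add: funpow_add period that)
  have mod: "(f ^^ n) x = (f ^^ (n mod d)) x" if "x \<in> S" for n x
  proof -
    have "(f ^^ n) x = (f ^^ (n mod d + n div d * d)) x"
      by simp
    also have "\<dots> = (f ^^ (n mod d)) x"
      by (simp only: funpow_add o_def period_mult[OF that])
    finally show ?thesis .
  qed
  \<comment> \<open>Elements of \<open>Bij S\<close> are extensional, hence the restriction.\<close>
  define F where "F n = restrict (f ^^ n) S" for n
  have F_mod: "F m = F n" if "\<sigma> [^] m = \<sigma> [^] n" for m n :: nat
  proof -
    have "\<sigma> [^] int m = \<sigma> [^] int n"
      using that by (simp add: int_pow_int)
    then have "int d dvd int n - int m"
      using int_pow_eq[OF \<sigma>(1)] ord by blast
    then have "m mod d = n mod d"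
      by (metis mod_eq_dvd_iff zmod_int of_nat_eq_iff)
    then show ?thesis
      unfolding F_def using mod by (metis restrict_ext)
  qed
  have F_add: "compose S (F m) (F n) = F (m + n)" for m n
    by (rule ext) (auto simp: F_def compose_def funpow_add closed_pow)
  have F_Bij: "F n \<in> Bij S" for n
  proof -
    \<comment> \<open>Makes \<open>n * d - n\<close> an honest difference, so that the iterate with
      this exponent inverts \<open>f ^^ n\<close> on \<open>S\<close>.\<close>
    have "n \<le> n * d"
      using d by simp
    then have "bij_betw (f ^^ n) S S"
      using period_mult[of _ n] closed_pow
      by (intro bij_betw_byWitness[where f' = "f ^^ (n * d - n)"])
         (auto simp flip: funpow_add[THEN fun_cong, unfolded o_apply])
    then show ?thesis
      unfolding Bij_def F_def by (auto simp: bij_betw_restrict_eq)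
  qed
  \<comment> \<open>By \<open>F_mod\<close> the choice of the exponent does not matter.\<close>
  define \<phi> where "\<phi> g = F (SOME n::nat. \<sigma> [^] n = g)" for g
  have \<phi>_pow: "\<phi> (\<sigma> [^] n) = F n" for n :: nat
    unfolding \<phi>_def by (rule F_mod, rule someI[of "\<lambda>m. \<sigma> [^] m = \<sigma> [^] n"]) simp
  have pow: "\<exists>n::nat. g = \<sigma> [^] n" if "g \<in> carrier G" for g
    using generate_pow_nat[OF \<sigma>(1)] that \<sigma>(2) ord d by auto
  have "\<phi> \<in> hom G (BijGroup S)"
  proof (rule homI)
    fix g assume "g \<in> carrier G"
    then show "\<phi> g \<in> carrier (BijGroup S)"
      using pow[of g] \<phi>_pow F_Bij by (auto simp: BijGroup_def)
  next
    fix g h assume "g \<in> carrier G" "h \<in> carrier G"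
    then obtain m n :: nat where gh: "g = \<sigma> [^] m" "h = \<sigma> [^] n"
      using pow by blast
    then have "\<phi> (g \<otimes> h) = F (m + n)"
      using \<phi>_pow[of "m + n"] \<sigma>(1) by (simp add: nat_pow_mult)
    then show "\<phi> (g \<otimes> h) = \<phi> g \<otimes>\<^bsub>BijGroup S\<^esub> \<phi> h"
      by (simp add: gh \<phi>_pow BijGroup_def F_Bij F_add)
  qed
  then have "group_action G S \<phi>"
    unfolding group_action_def group_hom_def group_hom_axioms_def
    using group_BijGroup by (simp add: is_group)
  moreover have "\<forall>x\<in>S. \<phi> \<sigma> x = f x"
    using \<phi>_pow[of 1] \<sigma>(1) by (simp add: F_def)
  ultimately show ?thesis
    by blast
qed

section \<open>Cyclic shifts\<close>

lemma length_cyc_shift [simp]: "length (cyc_shift b) = length b"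
  by (simp add: cyc_shift_def)

text \<open>Facts about \<open>rotate1\<close> carry over to \<open>cyc_shift\<close> through this
  inverse relation.\<close>

lemma rotate1_cyc_shift [simp]: "rotate1 (cyc_shift b) = b"
  by (simp add: cyc_shift_def)

lemma cyc_shift_rotate1 [simp]: "cyc_shift (rotate1 b) = b"
  by (cases b) (simp_all add: cyc_shift_def)

lemma set_cyc_shift [simp]: "set (cyc_shift b) = set b"
  by (metis rotate1_cyc_shift set_rotate1)

lemma count_list_rotate1 [simp]: "count_list (rotate1 b) x = count_list b x"
  by (cases b) simp_all

lemma count_list_cyc_shift [simp]: "count_list (cyc_shift b) x = count_list b x"
  by (metis rotate1_cyc_shift count_list_rotate1)

lemma sum_list_rotate1 [simp]: "sum_list (rotate1 b) = sum_list (b :: 'a::comm_monoid_add list)"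
  by (cases b) (simp_all add: add.commute)

lemma sum_list_cyc_shift [simp]:
  "sum_list (cyc_shift b) = sum_list (b :: 'a::comm_monoid_add list)"
  by (metis rotate1_cyc_shift sum_list_rotate1)

lemma cyc_shift_inject [simp]: "cyc_shift a = cyc_shift b \<longleftrightarrow> a = b"
  by (metis rotate1_cyc_shift)

text \<open>Shifting \<open>n\<close> times undoes \<open>rotate n\<close>, and rotating by the full
  length is the identity.\<close>

lemma funpow_cyc_shift_length: "(cyc_shift ^^ length b) b = b"
proof -
  have "(cyc_shift ^^ n) (rotate n b) = b" for n
    by (induction n) (simp_all add: funpow_swap1)
  from this[of "length b"] show ?thesis
    by simp
qed

text \<open>By injectivity of the shift. A block that moves therefore still moves after any number
  of shifts.\<close>

lemma cyc_shift_funpow_fixed: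
  "cyc_shift ((cyc_shift ^^ n) b) = (cyc_shift ^^ n) b \<longleftrightarrow> cyc_shift b = b"
  by (induction n) simp_all

lemma cyc_shift_fixed_iff: "cyc_shift b = b \<longleftrightarrow> (\<exists>x. b = replicate (length b) x)"
proof
  assume fixed: "cyc_shift b = b"
  show "\<exists>x. b = replicate (length b) x"
  proof (cases b)
    case (Cons a as)
    with fixed have "rotate1 (a # as) = a # as"
      by (metis rotate1_cyc_shift)
    \<comment> \<open>Commuting with the one-letter word \<open>[a]\<close> forces every letter of
      \<open>as\<close> to be \<open>a\<close>.\<close>
    then have "as @ [a] = [a] @ as"
      by simp
    then have "as = replicate (length as) a"
    proof (induction as)
      case (Cons y ys)
      then show ?case by auto
    qed simp
    then show ?thesis
      using Cons by (metis length_Cons replicate_Suc)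
  qed simp
next
  assume "\<exists>x. b = replicate (length b) x"
  then obtain x where x: "b = replicate (length b) x" ..
  have "rotate1 (replicate n x) = replicate n x" for n
    by (cases n) (simp_all add: replicate_append_same)
  then show "cyc_shift b = b"
    using x by (metis cyc_shift_rotate1)
qed

section \<open>Rotating the first non-constant block\<close>

text \<open>Describes the prefix in front of the first moved block, so that the \<open>LEAST\<close>
  in \<open>sigma_bullet\<close> can be traded for a decomposition \<open>A @ B @ D\<close>.\<close>

definition fixed_blocks :: "nat \<Rightarrow> 'a list \<Rightarrow> nat \<Rightarrow> bool" where
  "fixed_blocks d A n \<longleftrightarrow>
     length A = n * d \<and> (\<forall>j. 1 \<le> j \<and> j \<le> n \<longrightarrow> cyc_shift (block d A j) = block d A j)"

lemma block_append:
  assumes "length A = n * d" "1 \<le> j" "j \<le> n"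
  shows "block d (A @ w) j = block d A j"
proof -
  have "(j - 1) * d + d = j * d"
    using assms(2) by (cases j) simp_all
  also have "\<dots> \<le> n * d"
    using assms(3) by simp
  finally show ?thesis
    using assms(1) by (simp add: block_def)
qed

lemma sigma_bullet_append:
  assumes A: "fixed_blocks d A n" and B: "length B = d" "cyc_shift B \<noteq> B"
  shows "sigma_bullet d (A @ B @ D) = A @ cyc_shift B @ D"
proof -
  let ?w = "A @ B @ D"
  have len: "length A = n * d"
    using A by (simp add: fixed_blocks_def)
  \<comment> \<open>For \<open>d = 0\<close> the block \<open>B\<close> would be empty, hence
    fixed.\<close>
  have "d > 0"
    using B by (cases d) (auto simp: cyc_shift_def)
  have blk: "block d ?w (Suc n) = B"
    using len B by (simp add: block_def)
  have moved: "moved_block d ?w (Suc n)"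
    unfolding moved_block_def blk using B len \<open>d > 0\<close>
    by (simp add: less_eq_div_iff_mult_less_eq)
  have "(LEAST j. moved_block d ?w j) = Suc n"
  proof (rule Least_equality)
    show "moved_block d ?w (Suc n)"
      by (fact moved)
  next
    fix j assume j: "moved_block d ?w j"
    show "Suc n \<le> j"
    proof (rule ccontr)
      assume "\<not> Suc n \<le> j"
      with j have "1 \<le> j" "j \<le> n"
        by (auto simp: moved_block_def)
      then show False
        using j A block_append[OF len, of j "B @ D"]
        by (simp add: moved_block_def fixed_blocks_def)
    qed
  qed
  then show ?thesis
    using moved blk len B unfolding sigma_bullet_def by (auto simp: Let_def)
qed

text \<open>The shifted block again has length \<open>d\<close> and is not fixed, so the same
  decomposition serves at every iteration.\<close>

lemma funpow_sigma_bullet_append: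
  assumes "fixed_blocks d A n" "length B = d" "cyc_shift B \<noteq> B"
  shows "(sigma_bullet d ^^ m) (A @ B @ D) = A @ (cyc_shift ^^ m) B @ D"
proof (induction m)
  case (Suc m)
  have "length ((cyc_shift ^^ m) B) = d"
    using assms(2) by (induction m) simp_all
  then show ?case
    using Suc assms by (simp add: sigma_bullet_append cyc_shift_funpow_fixed)
qed simp

lemma first_moved_block:
  assumes "sigma_bullet d w \<noteq> w"
  obtains A B D n where "w = A @ B @ D" "fixed_blocks d A n" "length B = d" "cyc_shift B \<noteq> B"
proof -
  define j where "j = (LEAST j. moved_block d w j)"
  have "\<exists>j. moved_block d w j"
    using assms by (auto simp: sigma_bullet_def split: if_splits)
  then have j: "moved_block d w j"
    unfolding j_def by (rule LeastI_ex)
  have least: "\<not> moved_block d w i" if "i < j" for i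
    using that not_less_Least unfolding j_def by blast
  obtain n where n: "j = Suc n"
    using j by (cases j) (auto simp: moved_block_def)
  let ?A = "take (n * d) w" and ?B = "block d w j" and ?D = "drop (j * d) w"
  have "j * d \<le> length w"
    using j by (metis moved_block_def div_times_less_eq_dividend le_trans mult_le_mono1)
  then have le: "n * d + d \<le> length w"
    by (simp add: n add.commute)
  show ?thesis
  proof
    show w: "w = ?A @ ?B @ ?D"
      unfolding block_def n
      by (metis add.commute append_take_drop_id diff_Suc_1 drop_drop mult_Suc)
    have len: "length ?A = n * d"
      using le by simp
    have "cyc_shift (block d ?A i) = block d ?A i" if "1 \<le> i" "i \<le> n" for i
    proof -
      have "block d ?A i = block d w i"
        using block_append[OF len that, of "?B @ ?D"] w by metis
      moreover have "i \<le> length w div d"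
        using that j n by (simp add: moved_block_def)
      ultimately show ?thesis
        using least[of i] that n by (simp add: moved_block_def)
    qed
    then show "fixed_blocks d ?A n"
      using len by (simp add: fixed_blocks_def)
    show "length ?B = d"
      using le by (simp add: block_def n)
    show "cyc_shift ?B \<noteq> ?B"
      using j by (simp add: moved_block_def)
  qed
qed

lemma sigma_bullet_period: "(sigma_bullet d ^^ d) w = w"
proof (cases "sigma_bullet d w = w")
  case True
  then have "(sigma_bullet d ^^ m) w = w" for m
    by (induction m) simp_all
  then show ?thesis .
next
  case False
  then obtain A B D n where
    "w = A @ B @ D" "fixed_blocks d A n" "length B = d" "cyc_shift B \<noteq> B"
    by (rule first_moved_block)
  then show ?thesis
    using funpow_cyc_shift_length[of B] by (simp add: funpow_sigma_bullet_append)
qed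

text \<open>Each block is constant and so contributes either \<open>0\<close> or \<open>d\<close>
  occurrences of \<open>x\<close>.\<close>

lemma dvd_count_list_fixed_blocks:
  "fixed_blocks d A n \<Longrightarrow> d dvd count_list A x"
proof (induction n arbitrary: A)
  case (Suc n)
  let ?A = "take (n * d) A" and ?B = "drop (n * d) A"
  have len: "length A = n * d + d"
    using Suc.prems by (simp add: fixed_blocks_def)
  then have lenA: "length ?A = n * d"
    by simp
  have "block d ?A i = block d A i" if "1 \<le> i" "i \<le> n" for i
    using block_append[OF lenA that, of ?B] by simp
  then have "fixed_blocks d ?A n"
    using Suc.prems lenA by (simp add: fixed_blocks_def)
  then have "d dvd count_list ?A x"
    by (rule Suc.IH)
  moreover have "block d A (Suc n) = ?B"
    using len by (simp add: block_def)
  then have "cyc_shift ?B = ?B"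
    using Suc.prems by (auto simp: fixed_blocks_def)
  then obtain y where "?B = replicate d y"
    using len by (auto simp: cyc_shift_fixed_iff)
  then have "d dvd count_list ?B x"
    by (simp add: count_list_eq_length_filter filter_replicate)
  ultimately have "d dvd count_list (?A @ ?B) x"
    unfolding count_list_append by (rule dvd_add)
  then show ?case
    by simp
qed (simp add: fixed_blocks_def)

section \<open>Characterisation of the words\<close>

text \<open>The index \<open>i\<close> counts the zeros already read; \<open>c i\<close> is the nonzero letter allowed at that stage.\<close>
fun fits :: "(nat \<Rightarrow> nat) \<Rightarrow> nat \<Rightarrow> nat list \<Rightarrow> bool" where
  "fits c i [] = True"
| "fits c i (x # xs) = (if x = 0 then fits c (Suc i) xs else x = c i \<and> fits c i xs)"

lemma fits_append: "fits c i (xs @ ys) \<longleftrightarrow> fits c i xs \<and> fits c (i + count_list xs 0) ys"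
  by (induction xs arbitrary: i) auto

text \<open>If the allowed letter stays the same while \<open>w\<close> is read, the order of the
  letters is irrelevant. The upper bound is inclusive because letters after the last zero are
  compared with \<open>c (i + count_list w 0)\<close>.\<close>

lemma fits_constant:
  assumes "\<And>j. i \<le> j \<Longrightarrow> j \<le> i + count_list w 0 \<Longrightarrow> c j = x"
  shows "fits c i w \<longleftrightarrow> set w \<subseteq> {0, x}"
  using assms
proof (induction w arbitrary: i)
  case (Cons y w)
  show ?case
  proof (cases "y = 0")
    case True
    then have "fits c (Suc i) w \<longleftrightarrow> set w \<subseteq> {0, x}"
      using Cons.prems by (intro Cons.IH) auto
    then show ?thesis
      using True by simp
  next
    case False
    then have "fits c i w \<longleftrightarrow> set w \<subseteq> {0, x}"
      using Cons.prems by (intro Cons.IH) auto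
    then show ?thesis
      using False Cons.prems[of i] by auto
  qed
qed simp

lemma fits_replicate: "c i \<noteq> 0 \<Longrightarrow> fits c i (replicate n (c i))"
  by (induction n) simp_all

text \<open>Generalises \<open>word_of\<close> to arbitrary letter and multiplicity functions, which
  permits induction on the number of groups.\<close>

definition group_word :: "(nat \<Rightarrow> nat) \<Rightarrow> (nat \<Rightarrow> nat) \<Rightarrow> nat \<Rightarrow> nat list" where
  "group_word c m n =
     concat (map (\<lambda>i. (if i = 0 then [] else [0]) @ replicate (m i) (c i)) [0..<n])"

lemma group_word_Suc:
  "group_word c m (Suc n) =
     group_word c m n @ (if n = 0 then [] else [0]) @ replicate (m n) (c n)"
  by (simp add: group_word_def)

lemma group_word_cong: "(\<And>i. i < n \<Longrightarrow> m i = m' i) \<Longrightarrow> group_word c m n = group_word c m' n"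
  unfolding group_word_def by (rule arg_cong[where f = concat]) simp

text \<open>As the group letters are nonzero, the zeros are exactly the \<open>n\<close> separators
  of the \<open>Suc n\<close> groups.\<close>

lemma group_word_properties:
  assumes "\<And>i. i \<le> n \<Longrightarrow> c i \<noteq> 0"
  shows "fits c 0 (group_word c m (Suc n)) \<and> count_list (group_word c m (Suc n)) 0 = n \<and>
         sum_list (group_word c m (Suc n)) = (\<Sum>i<Suc n. c i * m i)"
  using assms
proof (induction n)
  case 0
  then show ?case
    by (simp add: group_word_def fits_replicate sum_list_replicate)
next
  case (Suc n)
  then show ?case
    unfolding group_word_Suc[of c m "Suc n"]
    by (simp add: fits_append fits_replicate sum_list_replicate)
qed

text \<open>The multiplicities are recovered letter by letter: a further zero opens an empty group,
  any other letter lengthens the last group.\<close>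

lemma fits_imp_group_word:
  assumes "fits c 0 w"
  shows "\<exists>m. w = group_word c m (Suc (count_list w 0))"
  using assms
proof (induction w rule: rev_induct)
  case Nil
  show ?case
    by (rule exI[of _ "\<lambda>_. 0"]) (simp add: group_word_def)
next
  case (snoc x w)
  let ?n = "count_list w 0"
  obtain m where m: "w = group_word c m (Suc ?n)"
    using snoc by (auto simp: fits_append)
  show ?case
  proof (cases "x = 0")
    case True
    let ?m = "m(Suc ?n := 0)"
    have "group_word c ?m (Suc ?n) = group_word c m (Suc ?n)"
      by (rule group_word_cong) simp
    then have "w @ [x] = group_word c ?m (Suc (Suc ?n))"
      using m True by (simp add: group_word_Suc[of c _ "Suc ?n"])
    moreover have "count_list (w @ [x]) 0 = Suc ?n"
      using True by simp
    ultimately show ?thesis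
      by metis
  next
    case False
    let ?m = "m(?n := Suc (m ?n))"
    have "group_word c ?m ?n = group_word c m ?n"
      by (rule group_word_cong) simp
    then have "group_word c ?m (Suc ?n) = group_word c m (Suc ?n) @ [c ?n]"
      by (simp add: group_word_Suc replicate_append_same)
    moreover have "x = c ?n"
      using snoc.prems False by (simp add: fits_append)
    ultimately have "w @ [x] = group_word c ?m (Suc ?n)"
      using m by simp
    moreover have "count_list (w @ [x]) 0 = ?n"
      using False by simp
    ultimately show ?thesis
      by metis
  qed
qed

section \<open>Multiplicity tuples and membership in \<open>words\<close>\<close>

lemma word_of_group_word:
  "word_of d \<nu> m = group_word (\<lambda>i. \<nu> ! (i div d)) ((!) m) (length \<nu> * d)"
  by (simp add: word_of_def group_word_def)

lemma weighted_sum_blocks: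
  fixes f g :: "nat \<Rightarrow> nat"
  shows "(\<Sum>j<k. f j * (\<Sum>i<d. g (j * d + i))) = (\<Sum>i<k * d. f (i div d) * g i)"
proof -
  have "(\<Sum>i<k * d. f (i div d) * g i) = (\<Sum>j<k. \<Sum>i=j * d..<j * d + d. f (i div d) * g i)"
    by (simp add: sum.nat_group)
  also have "\<dots> = (\<Sum>j<k. f j * (\<Sum>i<d. g (j * d + i)))"
  proof (rule sum.cong[OF refl])
    fix j
    have "(\<Sum>i=j * d..<j * d + d. f (i div d) * g i) =
          (\<Sum>i<d. f ((j * d + i) div d) * g (j * d + i))"
      using sum.shift_bounds_nat_ivl[of "\<lambda>i. f (i div d) * g i" 0 "j * d" d]
      by (simp add: lessThan_atLeast0 add.commute)
    also have "\<dots> = (\<Sum>i<d. f j * g (j * d + i))"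
      by (rule sum.cong) auto
    finally show "(\<Sum>i=j * d..<j * d + d. f (i div d) * g i) = f j * (\<Sum>i<d. g (j * d + i))"
      by (simp add: sum_distrib_left)
  qed
  finally show ?thesis ..
qed

text \<open>Eliminates the tuple, so that membership can be tested on a rotated word
  directly.\<close>

lemma words_iff:
  assumes "d > 0" "\<nu> \<noteq> []" and pos: "\<forall>j<length \<nu>. \<nu> ! j > 0"
  shows "w \<in> words d \<nu> l \<longleftrightarrow>
         fits (\<lambda>i. \<nu> ! (i div d)) 0 w \<and> Suc (count_list w 0) = length \<nu> * d \<and> sum_list w = l"
    (is "_ \<longleftrightarrow> ?R")
proof -
  let ?c = "\<lambda>i. \<nu> ! (i div d)"
  \<comment> \<open>There is at least one group, so \<open>N\<close> is the true number of
    separating zeros.\<close>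
  obtain N where N: "length \<nu> * d = Suc N"
    using assms by (cases "length \<nu> * d") auto
  have c: "?c i \<noteq> 0" if "i \<le> N" for i
  proof -
    have "i div d < length \<nu>"
      using that N by (intro less_mult_imp_div_less) simp
    then show ?thesis
      using pos by auto
  qed
  have props: "fits ?c 0 (group_word ?c m (Suc N))" "count_list (group_word ?c m (Suc N)) 0 = N"
    "sum_list (group_word ?c m (Suc N)) = (\<Sum>i<Suc N. ?c i * m i)" for m
    using group_word_properties[of N ?c m, OF c] by blast+
  show ?thesis
  proof
    assume "w \<in> words d \<nu> l"
    then obtain m where "m \<in> mult_tuples d \<nu> l" "w = word_of d \<nu> m"
      by (auto simp: words_def)
    then show ?R
      using props[of "(!) m"] N
      by (simp add: word_of_group_word mult_tuples_def
            weighted_sum_blocks[of "(!) \<nu>" "(!) m" d "length \<nu>"])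
  next
    assume R: ?R
    then obtain m where m: "w = group_word ?c m (Suc N)"
      using fits_imp_group_word[of ?c w] N by auto
    \<comment> \<open>Tabulates the multiplicity function as a list of the length that
      \<open>mult_tuples\<close> demands.\<close>
    let ?m = "map m [0..<Suc N]"
    have nth: "?m ! i = m i" if "i < Suc N" for i
      using that by (simp del: upt_Suc)
    have w: "w = word_of d \<nu> ?m"
      unfolding word_of_group_word N m by (rule group_word_cong) (simp add: nth del: upt_Suc)
    have "(\<Sum>i<Suc N. ?c i * ?m ! i) = (\<Sum>i<Suc N. ?c i * m i)"
      by (rule sum.cong) (simp_all add: nth del: upt_Suc)
    then have "(\<Sum>j<length \<nu>. \<nu> ! j * (\<Sum>i<d. ?m ! (j * d + i))) = l"
      unfolding weighted_sum_blocks[of "(!) \<nu>" "(!) ?m" d "length \<nu>"] N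
      using R m props(3)[of m] by metis
    then have "?m \<in> mult_tuples d \<nu> l"
      by (simp add: mult_tuples_def N del: upt_Suc)
    then show "w \<in> words d \<nu> l"
      using w by (auto simp: words_def)
  qed
qed

section \<open>Closure under the rotation, and the action\<close>

lemma sigma_bullet_in_words:
  assumes "d > 0" "\<nu> \<noteq> []" "\<forall>j<length \<nu>. \<nu> ! j > 0" and w: "w \<in> words d \<nu> l"
  shows "sigma_bullet d w \<in> words d \<nu> l"
proof (cases "sigma_bullet d w = w")
  case False
  let ?c = "\<lambda>i. \<nu> ! (i div d)"
  obtain A B D n where ABD: "w = A @ B @ D" "fixed_blocks d A n" "length B = d" "cyc_shift B \<noteq> B"
    using False by (rule first_moved_block)
  obtain q where q: "count_list A 0 = q * d"
    using dvd_count_list_fixed_blocks[OF ABD(2), of 0] by (metis dvdE mult.commute)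
  have fits: "fits ?c 0 w"
    using w words_iff[OF assms(1-3)] by blast
  then have fB: "fits ?c (q * d) B"
    by (simp add: ABD(1) fits_append q)
  \<comment> \<open>Otherwise all \<open>d\<close> letters of \<open>B\<close> are zero and
    \<open>B\<close> is constant.\<close>
  have "count_list B 0 < d"
  proof (rule ccontr)
    assume "\<not> count_list B 0 < d"
    then have "length (filter ((=) 0) B) = length B"
      using length_filter_le[of "(=) 0" B] ABD(3) by (simp add: count_list_eq_length_filter)
    then have "\<forall>x\<in>set B. x = 0"
      using length_filter_less[of _ B "(=) 0"] by fastforce
    then have "B = replicate (length B) 0"
      by (simp add: replicate_eqI)
    then show False
      using ABD(4) cyc_shift_fixed_iff by blast
  qed
  \<comment> \<open>While \<open>B\<close> is read, the zero count stays in the interval from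
    \<open>q * d\<close> to \<open>q * d + d - 1\<close>.\<close>
  then have c: "?c j = \<nu> ! q" if "q * d \<le> j" "j \<le> q * d + count_list B 0" for j
  proof -
    have "j div d = q"
      using that \<open>count_list B 0 < d\<close> by (intro div_nat_eqI) (simp_all add: mult.commute)
    then show ?thesis
      by simp
  qed
  have "fits ?c (q * d) B \<longleftrightarrow> set B \<subseteq> {0, \<nu> ! q}"
    using c by (rule fits_constant)
  moreover have "fits ?c (q * d) (cyc_shift B) \<longleftrightarrow> set (cyc_shift B) \<subseteq> {0, \<nu> ! q}"
    by (rule fits_constant) (rule c, simp_all)
  ultimately have "fits ?c (q * d) (cyc_shift B)"
    using fB by simp
  \<comment> \<open>The shift preserves the number of zeros in \<open>B\<close>, so \<open>D\<close>
    is read from the same index as before.\<close>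
  then have "fits ?c 0 (A @ cyc_shift B @ D)"
    using fits by (simp add: ABD(1) fits_append q)
  then show ?thesis
    using w unfolding words_iff[OF assms(1-3)]
    by (simp add: ABD(1) sigma_bullet_append[OF ABD(2-4)])
qed (simp add: w)

theorem theorem3p6:
  fixes d k l :: nat and \<nu> :: "nat list"
    and C :: "('g, 'h) monoid_scheme" and \<sigma> :: 'g
  assumes "d \<ge> 1" and "k \<ge> 1"
    and "length \<nu> = k" and "\<forall>j<k. \<nu> ! j > 0"
    and "group C" and "\<sigma> \<in> carrier C" and "carrier C = generate C {\<sigma>}" and "order C = d"
  shows "(\<forall>w \<in> words d \<nu> l. sigma_bullet d w \<in> words d \<nu> l) \<and>
         (\<exists>\<phi>. group_action C (words d \<nu> l) \<phi> \<and>
              (\<forall>w \<in> words d \<nu> l. \<phi> \<sigma> w = sigma_bullet d w))"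
proof -
  have closed: "sigma_bullet d w \<in> words d \<nu> l" if "w \<in> words d \<nu> l" for w
    using assms(1-4) that by (intro sigma_bullet_in_words) auto
  \<comment> \<open>Closure and \<open>d\<close>-periodicity are what the general construction asks
    of \<open>f\<close>.\<close>
  show ?thesis
    using closed group.cyclic_group_action[OF assms(5-8), of "words d \<nu> l" "sigma_bullet d"]
      assms(1) sigma_bullet_period
    by auto
qed

end
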